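(* Let $p:\mathbb{R}^n \to \mathbb{R}$ be a function. Then $p$ is piecewise linear if and only if there exist finite index sets $I$ and $S$ and a (finite) two-index family of vectors $\{a_{is} \in \mathbb{R}^n \,|\, i \in I,\ s \in S\}$ such that $$p(x) = \min_{i \in I}\max_{s \in S}\langle a_{is}, x \rangle = \max_{s \in S}\min_{i \in I}\langle a_{is}, x \rangle \quad \forall\, x \in \mathbb{R}^n.$$ Moreover, for each piecewise linear function $p:\mathbb{R}^n \to \mathbb{R}$ the finite family $\{a_{is} \in \mathbb{R}^n \,|\, i \in I,\ s \in S\}$ satisfying these equalities can be chosen in such a manner that $a_{is} = b_s - c_i$ for all $i\in I$, $s\in S$, where $\{b_{s} \in \mathbb{R}^n \,|\, s \in S\}$ and $\{c_{i} \in \mathbb{R}^n \,|\, i \in I\}$ are two finite families of vectors in $\mathbb{R}^n$.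
   Context: A function $p:\mathbb{R}^n\to\mathbb{R}$ is called piecewise linear if it is continuous and there exists a finite covering of $\mathbb{R}^n$ by solid convex cones (convex cones with nonempty interior) $K_1,\ldots,K_m$ such that, for each $j=1,\ldots,m$, the restriction of $p$ to $K_j$ coincides with the restriction to $K_j$ of some linear function. $\langle\cdot,\cdot\rangle$ denotes the standard inner product on $\mathbb{R}^n$. The finite index sets $I$ and $S$ are nonempty, so that the minima and maxima make sense. *)

theory Defs
  imports "HOL-Analysis.Analysis"
begin

text \<open>A cone is solid if it has nonempty interior. The cones of the covering are not required
  to be closed, polyhedral or non-overlapping. The predicate \<^const>\<open>convex_cone\<close> requires closure
  under all scalars \<open>c \<ge> 0\<close>, so the apex \<open>0\<close> belongs to each cone.\<close>

definition piecewise_linear :: "(real ^ 'n \<Rightarrow> real) \<Rightarrow> bool" where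
  "piecewise_linear p \<longleftrightarrow>
     continuous_on UNIV p \<and>
     (\<exists>\<K>. finite \<K> \<and> \<Union>\<K> = UNIV \<and>
        (\<forall>K\<in>\<K>. convex_cone K \<and> interior K \<noteq> {} \<and>
           (\<exists>l. linear l \<and> (\<forall>x\<in>K. p x = l x))))"

end

theory Submission
  imports Defs
begin

text \<open>
  The key observation is that a piecewise linear function \<open>p\<close> is a continuous selection of finitely
  many linear functions: at each point it takes the value of one of them. The cones themselves can
  then be forgotten. Restricting \<open>p\<close> to a segment from \<open>x\<close> to \<open>y\<close> and looking at the last point where
  \<open>p\<close> crosses its chord from below shows that some \<open>a\<close> among the selected vectors satisfies
  \<open>a \<bullet> x \<le> p x\<close> and \<open>a \<bullet> y \<ge> p y\<close> (\<open>selection_separates\<close>). Consequently \<open>p\<close> is the maximum over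
  \<open>y\<close> of the functions \<open>MIN a\<in>M y. a \<bullet> x\<close>, where \<open>M y\<close> consists of the \<open>a\<close> with \<open>a \<bullet> y \<ge> p y\<close>; only
  finitely many sets \<open>M y\<close> occur.

  Differences of two maxima of linear functions are closed under negation and finite maxima, hence
  under finite minima, so \<open>p\<close> is of the form \<open>(MAX s. b s \<bullet> x) - (MAX i. c i \<bullet> x)\<close>. In such an
  expression the two indices are decoupled, and it equals both the min-max and the max-min of
  \<open>(b s - c i) \<bullet> x\<close>. This gives the forward implication in its strong form.

  For the converse, cut the space by the hyperplanes on which two of the given linear functions agree.
  Within one closed chamber the values of the linear functions are ordered in the same way everywhere,
  so a min-max expression selects the same function throughout (\<open>Min_Max_order_transfer\<close>). The
  chambers of points off the hyperplanes are solid, and they cover the space because these points are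
  dense and the finitely many chambers are closed.
\<close>

section \<open>Differences of maxima of linear functions\<close>

definition max_linear :: "('a::real_inner \<Rightarrow> real) \<Rightarrow> bool" where
  "max_linear f \<longleftrightarrow> (\<exists>A. finite A \<and> A \<noteq> {} \<and> (\<forall>x. f x = (MAX a\<in>A. a \<bullet> x)))"

definition diff_max_linear :: "('a::real_inner \<Rightarrow> real) \<Rightarrow> bool" where
  "diff_max_linear f \<longleftrightarrow> (\<exists>g h. max_linear g \<and> max_linear h \<and> (\<forall>x. f x = g x - h x))"

lemma max_linear_inner: "max_linear (\<lambda>x. a \<bullet> x)"
  unfolding max_linear_def by (rule exI[of _ "{a}"]) auto

lemma max_linear_max:
  assumes "max_linear f" "max_linear g"
  shows "max_linear (\<lambda>x. max (f x) (g x))"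
proof -
  obtain A B where "finite A" "A \<noteq> {}" "\<And>x. f x = (MAX a\<in>A. a \<bullet> x)"
    and "finite B" "B \<noteq> {}" "\<And>x. g x = (MAX a\<in>B. a \<bullet> x)"
    using assms unfolding max_linear_def by metis
  then show ?thesis
    unfolding max_linear_def
    by (intro exI[of _ "A \<union> B"]) (simp add: image_Un Max_Un)
qed

text \<open>Maxima of linear functions add by taking the Minkowski sum of the vector sets.\<close>

lemma max_linear_add:
  assumes "max_linear f" "max_linear g"
  shows "max_linear (\<lambda>x. f x + g x)"
proof -
  obtain A B where A: "finite A" "A \<noteq> {}" "\<And>x. f x = (MAX a\<in>A. a \<bullet> x)"
    and B: "finite B" "B \<noteq> {}" "\<And>x. g x = (MAX a\<in>B. a \<bullet> x)"
    using assms unfolding max_linear_def by metis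
  define C where "C = (\<lambda>(a, b). a + b) ` (A \<times> B)"
  have "f x + g x = (MAX c\<in>C. c \<bullet> x)" for x
  proof (rule Max_eqI[symmetric])
    obtain a b where "a \<in> A" "f x = a \<bullet> x" "b \<in> B" "g x = b \<bullet> x"
      unfolding A(3) B(3) using obtains_MAX[OF A(1,2)] obtains_MAX[OF B(1,2)] by metis
    then show "f x + g x \<in> (\<lambda>c. c \<bullet> x) ` C"
      by (force simp: C_def inner_add_left image_iff)
  next
    show "v \<le> f x + g x" if "v \<in> (\<lambda>c. c \<bullet> x) ` C" for v
      using that A B by (auto simp: C_def inner_add_left intro!: add_mono Max_ge)
  qed (use A B in \<open>simp add: C_def\<close>)
  then show ?thesis
    unfolding max_linear_def using A B by (intro exI[of _ C]) (auto simp: C_def)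
qed

lemma diff_max_linear_inner: "diff_max_linear (\<lambda>x. a \<bullet> x)"
  unfolding diff_max_linear_def
  using max_linear_inner[of a] max_linear_inner[of 0] by fastforce

lemma diff_max_linear_minus:
  assumes "diff_max_linear f"
  shows "diff_max_linear (\<lambda>x. - f x)"
proof -
  obtain g h where "max_linear g" "max_linear h" "\<And>x. f x = g x - h x"
    using assms unfolding diff_max_linear_def by auto
  then show ?thesis
    unfolding diff_max_linear_def by (intro exI[of _ h] exI[of _ g]) simp
qed

lemma diff_max_linear_max:
  assumes "diff_max_linear f" "diff_max_linear g"
  shows "diff_max_linear (\<lambda>x. max (f x) (g x))"
proof -
  obtain f1 f2 g1 g2 where f: "max_linear f1" "max_linear f2" "\<And>x. f x = f1 x - f2 x"
    and g: "max_linear g1" "max_linear g2" "\<And>x. g x = g1 x - g2 x"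
    using assms unfolding diff_max_linear_def by metis
  \<comment> \<open>Bring both differences to the common subtrahend \<open>f2 + g2\<close>.\<close>
  have "max (f x) (g x) = max (f1 x + g2 x) (g1 x + f2 x) - (f2 x + g2 x)" for x
    by (simp add: f g max_def)
  then show ?thesis
    unfolding diff_max_linear_def
    by (intro exI[of _ "\<lambda>x. max (f1 x + g2 x) (g1 x + f2 x)"] exI[of _ "\<lambda>x. f2 x + g2 x"])
       (simp add: f g max_linear_max max_linear_add)
qed

lemma diff_max_linear_Max:
  assumes "finite I" "I \<noteq> {}" "\<And>i. i \<in> I \<Longrightarrow> diff_max_linear (f i)"
  shows "diff_max_linear (\<lambda>x. MAX i\<in>I. f i x)"
  using assms
proof (induction I rule: finite_ne_induct)
  case (insert i I)
  then have "diff_max_linear (\<lambda>x. max (f i x) (MAX i\<in>I. f i x))"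
    by (intro diff_max_linear_max) auto
  with insert show ?case by simp
qed simp

lemma diff_max_linear_Min:
  assumes "finite I" "I \<noteq> {}" "\<And>i. i \<in> I \<Longrightarrow> diff_max_linear (f i)"
  shows "diff_max_linear (\<lambda>x. MIN i\<in>I. f i x)"
proof -
  have "(\<lambda>x. MIN i\<in>I. f i x) = (\<lambda>x. - (MAX i\<in>I. - f i x))"
    using assms(1,2) by (simp add: image_image)
  moreover have "diff_max_linear (\<lambda>x. - (MAX i\<in>I. - f i x))"
    using assms by (intro diff_max_linear_minus diff_max_linear_Max)
  ultimately show ?thesis by (simp only:)
qed

section \<open>Continuous selections of linear functions\<close>

text \<open>The index is found at the last zero \<open>t0\<close> of \<open>G\<close>. To its right \<open>G\<close> is positive, and by
  finiteness a single affine piece is attained at points accumulating at \<open>t0\<close> from the right. That piece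
  vanishes at \<open>t0\<close> and is positive later, hence is increasing.\<close>

lemma affine_selection_crossing_strict:
  fixes G :: "real \<Rightarrow> real" and \<alpha> \<beta> :: "'j \<Rightarrow> real"
  assumes "finite J" and cont: "continuous_on {0..1} G"
    and sel: "\<And>t. t \<in> {0..1} \<Longrightarrow> \<exists>j\<in>J. G t = \<alpha> j + t * \<beta> j"
    and "G 0 < 0" "G 1 > 0"
  shows "\<exists>j\<in>J. \<alpha> j < 0 \<and> \<alpha> j + \<beta> j > 0"
proof -
  define Z where "Z = {t \<in> {0..1}. G t \<le> 0}"
  have "compact Z"
    unfolding Z_def using continuous_closed_preimage[OF cont, of "{..0}"]
    by (auto simp: compact_eq_bounded_closed vimage_def Int_def intro: bounded_subset[of "{0..1}"])
  moreover have "Z \<noteq> {}"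
    using \<open>G 0 < 0\<close> by (auto simp: Z_def intro!: exI[of _ 0])
  ultimately obtain t0 where t0: "t0 \<in> Z" and last: "\<And>t. t \<in> Z \<Longrightarrow> t \<le> t0"
    using compact_attains_sup by metis
  have t0_01: "0 \<le> t0" "t0 < 1"
    using t0 \<open>G 1 > 0\<close> by (auto simp: Z_def less_le)
  have pos: "G t > 0" if "t0 < t" "t \<le> 1" for t
    using last[of t] that t0_01 by (force simp: Z_def)
  define C where "C j = {t \<in> {t0<..1}. G t = \<alpha> j + t * \<beta> j}" for j
  have "{t0<..1} \<subseteq> (\<Union>j\<in>J. C j)"
    using sel t0_01 by (fastforce simp: C_def)
  then have "closure {t0<..1} \<subseteq> (\<Union>j\<in>J. closure (C j))"
  proof (rule closure_minimal[OF order_trans])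
    show "(\<Union>j\<in>J. C j) \<subseteq> (\<Union>j\<in>J. closure (C j))"
      by (intro UN_mono closure_subset order_refl)
    show "closed (\<Union>j\<in>J. closure (C j))"
      using \<open>finite J\<close> by (intro closed_UN) simp_all
  qed
  moreover have "t0 \<in> closure {t0<..1}"
    using t0_01 by simp
  ultimately obtain j where j: "j \<in> J" "t0 \<in> closure (C j)"
    by blast
  have "continuous_on {0..1} (\<lambda>t. G t - (\<alpha> j + t * \<beta> j))"
    by (intro continuous_intros cont)
  then have "closed {t \<in> {0..1}. G t - (\<alpha> j + t * \<beta> j) = 0}"
    by (rule continuous_closed_preimage_constant) simp
  moreover have "C j \<subseteq> {t \<in> {0..1}. G t - (\<alpha> j + t * \<beta> j) = 0}"
    using t0_01 by (auto simp: C_def)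
  ultimately have "closure (C j) \<subseteq> {t \<in> {0..1}. G t - (\<alpha> j + t * \<beta> j) = 0}"
    by (intro closure_minimal)
  with j have Gt0: "G t0 = \<alpha> j + t0 * \<beta> j"
    by auto
  have "G t0 = 0"
  proof (rule antisym)
    have "closed {t \<in> {0..1}. G t \<in> {0..}}"
      using continuous_closed_preimage[OF cont, of "{0..}"] by (simp add: vimage_def Int_def)
    moreover have "{t0<..1} \<subseteq> {t \<in> {0..1}. G t \<in> {0..}}"
      using pos t0_01 by (force intro: less_imp_le)
    ultimately have "closure {t0<..1} \<subseteq> {t \<in> {0..1}. G t \<in> {0..}}"
      by (intro closure_minimal)
    with \<open>t0 \<in> closure {t0<..1}\<close> show "0 \<le> G t0"
      by auto
  qed (use t0 in \<open>simp add: Z_def\<close>)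
  then have "t0 \<noteq> 0" using \<open>G 0 < 0\<close> by auto
  then have "0 < t0" using t0_01 by simp
  have "C j \<noteq> {}" using j by auto
  then obtain t where t: "t0 < t" "t \<le> 1" "G t = \<alpha> j + t * \<beta> j"
    by (auto simp: C_def)
  then have "(t - t0) * \<beta> j > 0"
    using pos[of t] Gt0 \<open>G t0 = 0\<close> by (simp add: algebra_simps)
  then have "\<beta> j > 0" using t by (simp add: zero_less_mult_iff)
  moreover have "\<alpha> j = - (t0 * \<beta> j)"
    using Gt0 \<open>G t0 = 0\<close> by simp
  moreover have "t0 * \<beta> j > 0" "(1 - t0) * \<beta> j > 0"
    using \<open>\<beta> j > 0\<close> \<open>0 < t0\<close> t0_01 by auto
  ultimately show ?thesis
    using j by (intro bexI[of _ j]) (auto simp: algebra_simps)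
qed

text \<open>Tilting \<open>G\<close> slightly makes the boundary inequalities strict. As there are finitely many pieces,
  a small enough tilt does not create a new piece with the required signs.\<close>

lemma affine_selection_crossing:
  fixes G :: "real \<Rightarrow> real" and \<alpha> \<beta> :: "'j \<Rightarrow> real"
  assumes "finite J" and cont: "continuous_on {0..1} G"
    and sel: "\<And>t. t \<in> {0..1} \<Longrightarrow> \<exists>j\<in>J. G t = \<alpha> j + t * \<beta> j"
    and "G 0 \<le> 0" "G 1 \<ge> 0"
  shows "\<exists>j\<in>J. \<alpha> j \<le> 0 \<and> \<alpha> j + \<beta> j \<ge> 0"
proof (rule ccontr)
  assume none: "\<not> ?thesis"
  define \<delta> where "\<delta> = (MIN j\<in>J. max (\<alpha> j) (- (\<alpha> j + \<beta> j)))"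
  have "J \<noteq> {}" using sel[of 0] by auto
  then have "\<delta> > 0"
    using none \<open>finite J\<close> by (force simp: \<delta>_def)
  have "\<exists>j\<in>J. \<alpha> j - \<delta>/2 < 0 \<and> (\<alpha> j - \<delta>/2) + (\<beta> j + \<delta>) > 0"
  proof (rule affine_selection_crossing_strict[where G = "\<lambda>t. G t - \<delta>/2 + t * \<delta>"])
    show "\<exists>j\<in>J. G t - \<delta>/2 + t * \<delta> = \<alpha> j - \<delta>/2 + t * (\<beta> j + \<delta>)" if "t \<in> {0..1}" for t
      using sel[OF that] by (auto simp: algebra_simps)
  qed (use assms \<open>\<delta> > 0\<close> in \<open>auto intro!: continuous_intros\<close>)
  then obtain j where "j \<in> J" and small: "max (\<alpha> j) (- (\<alpha> j + \<beta> j)) < \<delta>/2"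
    by (auto simp: max_def)
  then have "\<delta> \<le> max (\<alpha> j) (- (\<alpha> j + \<beta> j))"
    unfolding \<delta>_def using \<open>finite J\<close> by (intro Min_le) auto
  with small \<open>\<delta> > 0\<close> show False by simp
qed

text \<open>On the segment from \<open>x\<close> to \<open>y\<close>, the difference of \<open>p\<close> and its chord is a selection of affine
  functions that vanishes at both ends.\<close>

lemma selection_separates:
  fixes p :: "'a::real_inner \<Rightarrow> real"
  assumes "finite A" and cont: "continuous_on UNIV p"
    and sel: "\<And>z. \<exists>a\<in>A. p z = a \<bullet> z"
  shows "\<exists>a\<in>A. a \<bullet> x \<le> p x \<and> p y \<le> a \<bullet> y"
proof -
  define G where "G t = p (x + t *\<^sub>R (y - x)) - p x - t * (p y - p x)" for t
  have "\<exists>a\<in>A. a \<bullet> x - p x \<le> 0 \<and> (a \<bullet> x - p x) + (a \<bullet> (y - x) - (p y - p x)) \<ge> 0"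
  proof (rule affine_selection_crossing[where G = G])
    show "continuous_on {0..1} G"
      unfolding G_def by (intro continuous_intros continuous_on_compose2[OF cont]) auto
    show "\<exists>a\<in>A. G t = (a \<bullet> x - p x) + t * (a \<bullet> (y - x) - (p y - p x))" for t
      using sel[of "x + t *\<^sub>R (y - x)"] by (auto simp: G_def algebra_simps)
  qed (simp_all add: G_def \<open>finite A\<close>)
  then show ?thesis by (auto simp: inner_diff_right)
qed

text \<open>The outer maximum ranges over the finitely many sets \<open>{a \<in> A. p y \<le> a \<bullet> y}\<close>: the one for \<open>y = x\<close>
  contributes \<open>p x\<close> exactly, and separation shows that no other contributes more.\<close>

lemma selection_eq_Max_Min:
  fixes p :: "'a::real_inner \<Rightarrow> real"
  assumes "finite A" and cont: "continuous_on UNIV p"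
    and sel: "\<And>z. \<exists>a\<in>A. p z = a \<bullet> z"
  defines "M \<equiv> range (\<lambda>y. {a \<in> A. p y \<le> a \<bullet> y})"
  shows "finite M" "M \<noteq> {}" "\<And>B. B \<in> M \<Longrightarrow> finite B \<and> B \<noteq> {}"
    and "p x = (MAX B\<in>M. MIN a\<in>B. a \<bullet> x)"
proof -
  show fin: "finite M"
    by (rule finite_subset[of _ "Pow A"]) (auto simp: M_def \<open>finite A\<close>)
  show "M \<noteq> {}" by (simp add: M_def)
  show ne: "\<And>B. B \<in> M \<Longrightarrow> finite B \<and> B \<noteq> {}"
  proof -
    fix B assume "B \<in> M"
    then obtain y where B: "B = {a \<in> A. p y \<le> a \<bullet> y}" by (auto simp: M_def)
    moreover obtain a where "a \<in> A" "p y = a \<bullet> y" using sel by blast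
    ultimately have "a \<in> B" by simp
    then show "finite B \<and> B \<noteq> {}" using B \<open>finite A\<close> by auto
  qed
  show "p x = (MAX B\<in>M. MIN a\<in>B. a \<bullet> x)"
  proof (rule Max_eqI[symmetric])
    obtain a where a: "a \<in> A" "a \<bullet> x = p x" using sel[of x] by metis
    have "(MIN a\<in>{a \<in> A. p x \<le> a \<bullet> x}. a \<bullet> x) = p x"
    proof (rule Min_eqI)
      show "p x \<in> (\<lambda>a. a \<bullet> x) ` {a \<in> A. p x \<le> a \<bullet> x}"
        using a by (intro image_eqI[of _ _ a]) auto
    qed (use \<open>finite A\<close> in auto)
    then show "p x \<in> (\<lambda>B. MIN a\<in>B. a \<bullet> x) ` M"
      unfolding M_def by (intro image_eqI[OF _ rangeI]) (rule sym)
  next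
    fix v assume "v \<in> (\<lambda>B. MIN a\<in>B. a \<bullet> x) ` M"
    then obtain y where v: "v = (MIN a\<in>{a \<in> A. p y \<le> a \<bullet> y}. a \<bullet> x)"
      by (auto simp: M_def)
    obtain a where "a \<in> A" "a \<bullet> x \<le> p x" "p y \<le> a \<bullet> y"
      using selection_separates[OF \<open>finite A\<close> cont sel] by blast
    then show "v \<le> p x"
      unfolding v using \<open>finite A\<close> by (intro order_trans[OF Min_le]) auto
  qed (simp add: fin)
qed

text \<open>The adjoint of a linear functional at \<open>1\<close> is the vector that represents it.\<close>

lemma piecewise_linear_imp_selection:
  assumes "piecewise_linear p"
  obtains A where "finite A" "\<And>z. \<exists>a\<in>A. p z = a \<bullet> z"
proof -
  obtain \<K> where \<K>: "finite \<K>" "\<Union>\<K> = UNIV"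
    and "\<forall>K\<in>\<K>. \<exists>l. linear l \<and> (\<forall>x\<in>K. p x = l x)"
    using assms unfolding piecewise_linear_def by metis
  then obtain l where l: "\<And>K. K \<in> \<K> \<Longrightarrow> linear (l K)" "\<And>K x. K \<in> \<K> \<Longrightarrow> x \<in> K \<Longrightarrow> p x = l K x"
    by metis
  show thesis
  proof (rule that[of "(\<lambda>K. adjoint (l K) 1) ` \<K>"])
    fix z
    obtain K where "K \<in> \<K>" "z \<in> K" using \<K> by blast
    moreover from this have "p z = adjoint (l K) 1 \<bullet> z"
      using l adjoint_works[of "l K" z 1] by (simp add: inner_commute)
    ultimately show "\<exists>a\<in>(\<lambda>K. adjoint (l K) 1) ` \<K>. p z = a \<bullet> z" by blast
  qed (simp add: \<K>)
qed

lemma piecewise_linear_imp_diff_max_linear: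
  assumes "piecewise_linear p"
  shows "diff_max_linear p"
proof -
  obtain A where A: "finite A" "\<And>z. \<exists>a\<in>A. p z = a \<bullet> z"
    using piecewise_linear_imp_selection[OF assms] by metis
  have cont: "continuous_on UNIV p"
    using assms by (simp add: piecewise_linear_def)
  note rep = selection_eq_Max_Min[OF A(1) cont A(2)]
  have "p = (\<lambda>x. MAX B\<in>range (\<lambda>y. {a \<in> A. p y \<le> a \<bullet> y}). MIN a\<in>B. a \<bullet> x)"
    using rep(4) by (intro ext)
  moreover have "diff_max_linear \<dots>"
    using rep(1-3) by (intro diff_max_linear_Max diff_max_linear_Min diff_max_linear_inner) auto
  ultimately show ?thesis by simp
qed

section \<open>Min-max form of a difference of maxima\<close>

text \<open>The indices are decoupled: for every \<open>i\<close> the best \<open>s\<close> is the maximiser of \<open>u\<close>, and for every \<open>s\<close> the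
  best \<open>i\<close> is the maximiser of \<open>v\<close>. So the order of the two operations does not matter.\<close>

lemma Min_Max_diff:
  fixes u :: "'s \<Rightarrow> real" and v :: "'i \<Rightarrow> real"
  assumes "finite I" "I \<noteq> {}" "finite S" "S \<noteq> {}"
  shows "(MIN i\<in>I. MAX s\<in>S. u s - v i) = (MAX s\<in>S. u s) - (MAX i\<in>I. v i)"
    and "(MAX s\<in>S. MIN i\<in>I. u s - v i) = (MAX s\<in>S. u s) - (MAX i\<in>I. v i)"
proof -
  obtain s0 i0 where s0: "s0 \<in> S" "(MAX s\<in>S. u s) = u s0" and i0: "i0 \<in> I" "(MAX i\<in>I. v i) = v i0"
    using obtains_MAX[OF assms(3,4)] obtains_MAX[OF assms(1,2)] by metis
  have us: "u s \<le> u s0" if "s \<in> S" for s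
    using Max_ge[of "u ` S" "u s"] assms that by (simp add: s0)
  have vi: "v i \<le> v i0" if "i \<in> I" for i
    using Max_ge[of "v ` I" "v i"] assms that by (simp add: i0)
  have "(MAX s\<in>S. u s - v i) = u s0 - v i" for i
    using assms s0 us by (intro Max_eqI) auto
  moreover have "(MIN i\<in>I. u s0 - v i) = u s0 - v i0"
    using assms i0 vi by (intro Min_eqI) auto
  ultimately show "(MIN i\<in>I. MAX s\<in>S. u s - v i) = (MAX s\<in>S. u s) - (MAX i\<in>I. v i)"
    by (simp add: s0 i0)
  have "(MIN i\<in>I. u s - v i) = u s - v i0" for s
    using assms i0 vi by (intro Min_eqI) auto
  moreover have "(MAX s\<in>S. u s - v i0) = u s0 - v i0"
    using assms s0 us by (intro Max_eqI) auto
  ultimately show "(MAX s\<in>S. MIN i\<in>I. u s - v i) = (MAX s\<in>S. u s) - (MAX i\<in>I. v i)"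
    by (simp add: s0 i0)
qed

lemma max_linear_indexed:
  assumes "max_linear f"
  obtains I :: "nat set" and b where "finite I" "I \<noteq> {}" "\<And>x. f x = (MAX i\<in>I. b i \<bullet> x)"
proof -
  obtain A where A: "finite A" "A \<noteq> {}" "\<And>x. f x = (MAX a\<in>A. a \<bullet> x)"
    using assms unfolding max_linear_def by auto
  obtain b where "bij_betw b {0..<card A} A"
    using ex_bij_betw_nat_finite[OF \<open>finite A\<close>] by blast
  then have "b ` {0..<card A} = A" by (rule bij_betw_imp_surj_on)
  with A show thesis
    by (intro that[of "{0..<card A}" b]) (auto simp: image_image[symmetric, of "\<lambda>a. a \<bullet> _" b])
qed

section \<open>Min-max expressions are piecewise linear\<close>

text \<open>The position at which a min-max is attained can be read off from the order of the entries alone,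
  so it also serves every other array \<open>g\<close> that respects this order.\<close>

lemma Min_Max_order_transfer:
  fixes f :: "'i \<Rightarrow> 's \<Rightarrow> real"
  assumes "finite I" "I \<noteq> {}" "finite S" "S \<noteq> {}"
  shows "\<exists>i\<in>I. \<exists>s\<in>S. \<forall>g :: 'i \<Rightarrow> 's \<Rightarrow> real.
    (\<forall>i\<in>I. \<forall>s\<in>S. \<forall>i'\<in>I. \<forall>s'\<in>S. f i s \<le> f i' s' \<longrightarrow> g i s \<le> g i' s') \<longrightarrow>
    (MIN i\<in>I. MAX s\<in>S. g i s) = g i s"
proof -
  have "\<exists>s\<in>S. \<forall>s'\<in>S. f i s' \<le> f i s" for i
    using assms Max_in[of "f i ` S"] Max_ge[of "f i ` S"] by fastforce
  then obtain \<sigma> where \<sigma>: "\<And>i. \<sigma> i \<in> S" "\<And>i s. s \<in> S \<Longrightarrow> f i s \<le> f i (\<sigma> i)"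
    by metis
  obtain i where i: "i \<in> I" "\<And>i'. i' \<in> I \<Longrightarrow> f i (\<sigma> i) \<le> f i' (\<sigma> i')"
    using assms Min_in[of "(\<lambda>i. f i (\<sigma> i)) ` I"] Min_le[of "(\<lambda>i. f i (\<sigma> i)) ` I"] by fastforce
  show ?thesis
  proof (intro bexI[OF _ i(1)] bexI[OF _ \<sigma>(1)] allI impI)
    fix g :: "'i \<Rightarrow> 's \<Rightarrow> real"
    assume g: "\<forall>i\<in>I. \<forall>s\<in>S. \<forall>i'\<in>I. \<forall>s'\<in>S. f i s \<le> f i' s' \<longrightarrow> g i s \<le> g i' s'"
    have "(MAX s\<in>S. g i s) = g i (\<sigma> i)" if "i \<in> I" for i
      using assms \<sigma> g that by (intro Max_eqI) auto
    then have "(MIN i\<in>I. MAX s\<in>S. g i s) = (MIN i\<in>I. g i (\<sigma> i))"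
      by (intro arg_cong[where f = Min] image_cong) auto
    also have "\<dots> = g i (\<sigma> i)"
      using assms i \<sigma> g by (intro Min_eqI) auto
    finally show "(MIN i\<in>I. MAX s\<in>S. g i s) = g i (\<sigma> i)" .
  qed
qed

text \<open>Only weak inequalities are transferred from \<open>x\<close> to \<open>y\<close>, which makes the chamber closed; ties at
  \<open>x\<close> persist, so the chamber of a point with \<open>a \<bullet> x = b \<bullet> x\<close> for two distinct \<open>a\<close>, \<open>b\<close> in \<open>A\<close> lies in a
  hyperplane and is not solid.\<close>

definition chamber :: "'a::real_inner set \<Rightarrow> 'a \<Rightarrow> 'a set" where
  "chamber A x = {y. \<forall>a\<in>A. \<forall>b\<in>A. a \<bullet> x \<le> b \<bullet> x \<longrightarrow> a \<bullet> y \<le> b \<bullet> y}"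

lemma self_in_chamber: "x \<in> chamber A x"
  by (simp add: chamber_def)

lemma closed_chamber: "closed (chamber A x)"
proof -
  have "chamber A x = (\<Inter>a\<in>A. \<Inter>b\<in>{b\<in>A. a \<bullet> x \<le> b \<bullet> x}. {y. a \<bullet> y \<le> b \<bullet> y})"
    by (auto simp: chamber_def)
  then show ?thesis
    by (auto intro!: closed_INT closed_Collect_le continuous_intros)
qed

lemma convex_cone_chamber: "convex_cone (chamber A x)"
  unfolding convex_cone_def convex_def conic_def chamber_def
  by (auto simp: inner_add_right intro!: add_mono mult_left_mono)

text \<open>A chamber depends on its base point only through the induced preorder on \<open>A\<close>.\<close>

lemma finite_chambers:
  assumes "finite A"
  shows "finite (chamber A ` X)"
proof -
  let ?r = "\<lambda>x. {(a, b). a \<in> A \<and> b \<in> A \<and> a \<bullet> x \<le> b \<bullet> x}"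
  let ?c = "\<lambda>R. {y. \<forall>(a, b)\<in>R. a \<bullet> y \<le> b \<bullet> y}"
  have "chamber A ` X \<subseteq> ?c ` Pow (A \<times> A)"
  proof
    fix K assume "K \<in> chamber A ` X"
    then obtain x where "K = ?c (?r x)" by (auto simp: chamber_def)
    moreover have "?r x \<in> Pow (A \<times> A)" by auto
    ultimately show "K \<in> ?c ` Pow (A \<times> A)" by blast
  qed
  then show ?thesis
    using assms by (meson finite_Pow_iff finite_SigmaI finite_imageI finite_subset)
qed

definition separated_points :: "'a::real_inner set \<Rightarrow> 'a set" where
  "separated_points A = {x. inj_on (\<lambda>a. a \<bullet> x) A}"

text \<open>At a separated point, all inequalities between distinct elements of \<open>A\<close> are strict, hence stable
  under small perturbations.\<close>

lemma interior_chamber: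
  assumes "finite A" "x \<in> separated_points A"
  shows "x \<in> interior (chamber A x)"
proof -
  let ?U = "\<Inter>a\<in>A. \<Inter>b\<in>{b\<in>A. a \<bullet> x < b \<bullet> x}. {y. a \<bullet> y < b \<bullet> y}"
  have "open ?U"
    using assms(1) by (auto intro!: open_INT open_Collect_less continuous_intros)
  moreover have "x \<in> ?U" by auto
  moreover have "?U \<subseteq> chamber A x"
    using assms(2) by (fastforce simp: chamber_def separated_points_def inj_on_def less_le)
  ultimately show ?thesis by (rule interiorI)
qed

lemma closure_separated_points:
  fixes A :: "'a::euclidean_space set"
  assumes "finite A"
  shows "closure (separated_points A) = UNIV"
proof -
  let ?H = "\<Union>(a, b)\<in>{(a, b) \<in> A \<times> A. a \<noteq> b}. {x. (a - b) \<bullet> x = 0}"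
  have eq: "separated_points A = - ?H"
    by (auto simp: separated_points_def inj_on_def inner_diff_left)
  have "finite {(a, b) \<in> A \<times> A. a \<noteq> b}"
    by (rule finite_subset[of _ "A \<times> A"]) (use assms in auto)
  then have "negligible ?H"
    by (intro negligible_Union finite_imageI) (auto intro!: negligible_hyperplane)
  then have "interior ?H = {}"
    by (meson interior_subset negligible_subset open_interior open_not_negligible)
  then show ?thesis by (simp only: eq closure_complement) simp
qed

text \<open>A finite union of closed sets that contains a dense set is the whole space.\<close>

lemma chambers_cover:
  fixes A :: "'a::euclidean_space set"
  assumes "finite A"
  shows "(\<Union>x\<in>separated_points A. chamber A x) = UNIV"
proof -
  have "closed (\<Union>(chamber A ` separated_points A))"
    by (intro closed_Union finite_chambers assms) (auto simp: closed_chamber)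
  moreover have "separated_points A \<subseteq> \<Union>(chamber A ` separated_points A)"
    using self_in_chamber by blast
  ultimately have "closure (separated_points A) \<subseteq> \<Union>(chamber A ` separated_points A)"
    by (rule closure_minimal[rotated])
  then show ?thesis
    using closure_separated_points[OF assms] by auto
qed

lemma continuous_on_Max_image:
  fixes f :: "'i \<Rightarrow> 'a::topological_space \<Rightarrow> real"
  assumes "finite I" "I \<noteq> {}" "\<And>i. i \<in> I \<Longrightarrow> continuous_on X (f i)"
  shows "continuous_on X (\<lambda>x. MAX i\<in>I. f i x)"
  using assms
  by (induction I rule: finite_ne_induct) (auto intro!: continuous_on_max)

lemma continuous_on_Min_image:
  fixes f :: "'i \<Rightarrow> 'a::topological_space \<Rightarrow> real"
  assumes "finite I" "I \<noteq> {}" "\<And>i. i \<in> I \<Longrightarrow> continuous_on X (f i)"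
  shows "continuous_on X (\<lambda>x. MIN i\<in>I. f i x)"
  using assms
  by (induction I rule: finite_ne_induct) (auto intro!: continuous_on_min)

lemma piecewise_linear_Min_Max:
  fixes a :: "'i \<Rightarrow> 's \<Rightarrow> real ^ 'n"
  assumes fin: "finite I" "I \<noteq> {}" "finite S" "S \<noteq> {}"
  shows "piecewise_linear (\<lambda>x. MIN i\<in>I. MAX s\<in>S. a i s \<bullet> x)"
proof -
  let ?p = "\<lambda>x. MIN i\<in>I. MAX s\<in>S. a i s \<bullet> x"
  let ?A = "case_prod a ` (I \<times> S)"
  let ?\<K> = "chamber ?A ` separated_points ?A"
  have "finite ?A" using fin by simp
  have "convex_cone K \<and> interior K \<noteq> {} \<and> (\<exists>l. linear l \<and> (\<forall>x\<in>K. ?p x = l x))"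
    if "K \<in> ?\<K>" for K
  proof (intro conjI)
    from that obtain x where x: "x \<in> separated_points ?A" and K: "K = chamber ?A x" by auto
    show "convex_cone K" by (simp add: K convex_cone_chamber)
    show "interior K \<noteq> {}"
      using interior_chamber[OF \<open>finite ?A\<close> x] by (auto simp: K)
    obtain i s where *: "\<forall>g :: 'i \<Rightarrow> 's \<Rightarrow> real.
        (\<forall>i\<in>I. \<forall>s\<in>S. \<forall>i'\<in>I. \<forall>s'\<in>S. a i s \<bullet> x \<le> a i' s' \<bullet> x \<longrightarrow> g i s \<le> g i' s') \<longrightarrow>
        (MIN i\<in>I. MAX s\<in>S. g i s) = g i s"
      using Min_Max_order_transfer[OF fin, of "\<lambda>i s. a i s \<bullet> x"] by blast
    have "?p y = a i s \<bullet> y" if "y \<in> K" for y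
      by (rule *[rule_format]) (use that in \<open>auto simp: K chamber_def\<close>)
    moreover have "linear (\<lambda>y. a i s \<bullet> y)"
      by (intro bounded_linear.linear bounded_linear_inner_right)
    ultimately show "\<exists>l. linear l \<and> (\<forall>x\<in>K. ?p x = l x)" by blast
  qed
  moreover have "finite ?\<K>" "\<Union>?\<K> = UNIV"
    using finite_chambers[OF \<open>finite ?A\<close>] chambers_cover[OF \<open>finite ?A\<close>] by blast+
  moreover have "continuous_on UNIV ?p"
    using fin by (intro continuous_on_Min_image continuous_on_Max_image continuous_intros)
  ultimately show ?thesis
    unfolding piecewise_linear_def by blast
qed

section \<open>The representation theorem\<close>

theorem theorem4:
  fixes p :: "real ^ 'n \<Rightarrow> real"
  shows
    "(piecewise_linear p \<longleftrightarrow>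
       (\<exists>(I :: nat set) (S :: nat set) (a :: nat \<Rightarrow> nat \<Rightarrow> real ^ 'n).
          finite I \<and> I \<noteq> {} \<and> finite S \<and> S \<noteq> {} \<and>
          (\<forall>x. p x = (MIN i\<in>I. MAX s\<in>S. a i s \<bullet> x) \<and>
               p x = (MAX s\<in>S. MIN i\<in>I. a i s \<bullet> x))))
     \<and>
     (piecewise_linear p \<longrightarrow>
       (\<exists>(I :: nat set) (S :: nat set) (a :: nat \<Rightarrow> nat \<Rightarrow> real ^ 'n)
          (b :: nat \<Rightarrow> real ^ 'n) (c :: nat \<Rightarrow> real ^ 'n).
          finite I \<and> I \<noteq> {} \<and> finite S \<and> S \<noteq> {} \<and>
          (\<forall>i\<in>I. \<forall>s\<in>S. a i s = b s - c i) \<and>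
          (\<forall>x. p x = (MIN i\<in>I. MAX s\<in>S. a i s \<bullet> x) \<and>
               p x = (MAX s\<in>S. MIN i\<in>I. a i s \<bullet> x))))"
    (is "(?pl \<longleftrightarrow> ?minmax) \<and> (?pl \<longrightarrow> ?diff)")
proof -
  have diff: ?diff if pl: ?pl
  proof -
    obtain g h where "max_linear g" "max_linear h" and p: "\<And>x. p x = g x - h x"
      using piecewise_linear_imp_diff_max_linear[OF pl] unfolding diff_max_linear_def by metis
    from \<open>max_linear g\<close> obtain S :: "nat set" and b
      where S: "finite S" "S \<noteq> {}" "\<And>x. g x = (MAX s\<in>S. b s \<bullet> x)"
      using max_linear_indexed by blast
    from \<open>max_linear h\<close> obtain I :: "nat set" and c
      where I: "finite I" "I \<noteq> {}" "\<And>x. h x = (MAX i\<in>I. c i \<bullet> x)"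
      using max_linear_indexed by blast
    have "p x = (MIN i\<in>I. MAX s\<in>S. (b s - c i) \<bullet> x) \<and> p x = (MAX s\<in>S. MIN i\<in>I. (b s - c i) \<bullet> x)" for x
      using Min_Max_diff[OF I(1,2) S(1,2)] by (simp add: p S(3) I(3) inner_diff_left)
    then show ?thesis
      using I(1,2) S(1,2)
      by - (rule exI[of _ I], rule exI[of _ S], rule exI[of _ "\<lambda>i s. b s - c i"],
          rule exI[of _ b], rule exI[of _ c], blast)
  qed
  have ?pl if minmax: ?minmax
  proof -
    obtain I S :: "nat set" and a :: "nat \<Rightarrow> nat \<Rightarrow> real ^ 'n"
      where fin: "finite I" "I \<noteq> {}" "finite S" "S \<noteq> {}"
        and p: "\<forall>x. p x = (MIN i\<in>I. MAX s\<in>S. a i s \<bullet> x)"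
      using minmax by blast
    then have "p = (\<lambda>x. MIN i\<in>I. MAX s\<in>S. a i s \<bullet> x)" by blast
    then show ?thesis
      using piecewise_linear_Min_Max[OF fin] by simp
  qed
  moreover have ?minmax if ?diff
    using that by blast
  ultimately show ?thesis
    using diff by blast
qed

end
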